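(* Let $\mathbb{F}$ be a field of characteristic zero and $\chi:S_n\to\mathbb{C}^\times$ a character. Let $C$ be any arithmetic circuit and let $T_1,\ldots,T_m\in\mathbb{F}[x_{ij}:1\le i,j\le n]$ each be a product of linear polynomials. If $C(T_1,\ldots,T_m)=\mathrm{Imm}_\chi(M)$ where $M=(x_{ij})_{n\times n}$, then $\mathrm{trdeg}_{\mathbb{F}}\{T_1,\ldots,T_m\}=\Omega(n)$.
   Context: $\mathrm{Imm}_\chi(M)=\sum_{\sigma\in S_n}\chi(\sigma)\prod_{i=1}^n x_{i\sigma(i)}$. A linear polynomial is a polynomial of degree at most $1$. $\mathrm{trdeg}_{\mathbb{F}}$ of a finite set of polynomials is the size of a maximal subset that is algebraically independent over $\mathbb{F}$. *)

theory Defs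
  imports
    Complex_Main
    "HOL-Library.Poly_Mapping"
    "HOL-Algebra.Sym_Groups"
    "HOL-Algebra.Algebraic_Closure_Type"
begin

section \<open>Multivariate polynomials\<close>

text \<open>
  A monomial is a finitely supported exponent vector, and a polynomial is a finitely supported
  family of coefficients indexed by monomials; addition and (convolution) multiplication are
  the ring operations of \<^theory>\<open>HOL-Library.Poly_Mapping\<close>.
\<close>

type_synonym ('v, 'a) mpoly = "('v \<Rightarrow>\<^sub>0 nat) \<Rightarrow>\<^sub>0 'a"

definition Cst :: "'a::comm_ring_1 \<Rightarrow> ('v, 'a) mpoly"
  where "Cst c = Poly_Mapping.single 0 c"

definition Var :: "'v \<Rightarrow> ('v, 'a::comm_ring_1) mpoly"
  where "Var x = Poly_Mapping.single (Poly_Mapping.single x 1) 1"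

definition mpoly_vars :: "('v, 'a::comm_ring_1) mpoly \<Rightarrow> 'v set"
  where "mpoly_vars p = (\<Union>\<mu> \<in> Poly_Mapping.keys p. Poly_Mapping.keys \<mu>)"

definition monom_degree :: "('v \<Rightarrow>\<^sub>0 nat) \<Rightarrow> nat"
  where "monom_degree \<mu> = (\<Sum>x \<in> Poly_Mapping.keys \<mu>. Poly_Mapping.lookup \<mu> x)"

definition linear_mpoly :: "('v, 'a::comm_ring_1) mpoly \<Rightarrow> bool"
  where "linear_mpoly p \<longleftrightarrow> (\<forall>\<mu> \<in> Poly_Mapping.keys p. monom_degree \<mu> \<le> 1)"

definition mpoly_subst ::
    "('v \<Rightarrow> ('w, 'a::comm_ring_1) mpoly) \<Rightarrow> ('v, 'a) mpoly \<Rightarrow> ('w, 'a) mpoly"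
  where "mpoly_subst f p =
    (\<Sum>\<mu> \<in> Poly_Mapping.keys p. Cst (Poly_Mapping.lookup p \<mu>) *
       (\<Prod>x \<in> Poly_Mapping.keys \<mu>. f x ^ Poly_Mapping.lookup \<mu> x))"

text \<open>
  The polynomial ring in the variables \<open>x\<^sub>i\<^sub>j\<close> with \<open>1 \<le> i, j \<le> n\<close>; the variable
  \<open>x\<^sub>i\<^sub>j\<close> is \<open>Var (i, j)\<close>.
\<close>

definition matrix_mpolys :: "nat \<Rightarrow> (nat \<times> nat, 'a::comm_ring_1) mpoly set"
  where "matrix_mpolys n = {p. mpoly_vars p \<subseteq> {1..n} \<times> {1..n}}"

definition product_of_linear :: "nat \<Rightarrow> (nat \<times> nat, 'a::comm_ring_1) mpoly \<Rightarrow> bool"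
  where "product_of_linear n p \<longleftrightarrow>
    (\<exists>ls. (\<forall>l \<in> set ls. l \<in> matrix_mpolys n \<and> linear_mpoly l) \<and> p = prod_list ls)"


section \<open>Transcendence degree\<close>

text \<open>
  The potential annihilating polynomial \<open>q\<close> has the elements of \<open>S\<close> themselves as its variables,
  so that evaluating it at \<open>S\<close> is substitution along the identity.
\<close>

definition alg_independent :: "('v, 'a::field) mpoly set \<Rightarrow> bool"
  where "alg_independent S \<longleftrightarrow>
    (\<forall>q :: (('v, 'a) mpoly, 'a) mpoly.
       mpoly_vars q \<subseteq> S \<and> mpoly_subst (\<lambda>s. s) q = 0 \<longrightarrow> q = 0)"

text \<open>Meaningful for finite \<open>S\<close>; the empty set is always independent.\<close>

definition trdeg :: "('v, 'a::field) mpoly set \<Rightarrow> nat"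
  where "trdeg S = Max (card ` {B. B \<subseteq> S \<and> alg_independent B})"


section \<open>Arithmetic circuits\<close>

text \<open>
  A circuit is a directed acyclic graph given as the list of its gates in topological order: the
  arguments of a gate are (0-based) positions of strictly earlier gates, results may be reused
  arbitrarily often, the fan-in is unbounded, and the last gate is the output. Scalar labels on
  wires are expressed by constant and multiplication gates. The inputs are numbered \<open>1, \<dots>, m\<close>.
\<close>

datatype 'a gate =
    Input nat
  | Const 'a
  | Plus "nat list"
  | Times "nat list"

fun wf_gate :: "nat \<Rightarrow> nat \<Rightarrow> 'a gate \<Rightarrow> bool"
  where
    "wf_gate m k (Input i) \<longleftrightarrow> i \<in> {1..m}"
  | "wf_gate m k (Const c) \<longleftrightarrow> True"
  | "wf_gate m k (Plus js) \<longleftrightarrow> (\<forall>j \<in> set js. j < k)"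
  | "wf_gate m k (Times js) \<longleftrightarrow> (\<forall>j \<in> set js. j < k)"

definition arith_circuit :: "nat \<Rightarrow> 'a gate list \<Rightarrow> bool"
  where "arith_circuit m C \<longleftrightarrow> C \<noteq> [] \<and> (\<forall>k < length C. wf_gate m k (C ! k))"

fun gate_value ::
    "(nat \<Rightarrow> ('v, 'a::comm_ring_1) mpoly) \<Rightarrow> ('v, 'a) mpoly list \<Rightarrow> 'a gate \<Rightarrow> ('v, 'a) mpoly"
  where
    "gate_value T vs (Input i) = T i"
  | "gate_value T vs (Const c) = Cst c"
  | "gate_value T vs (Plus js) = (\<Sum>j \<leftarrow> js. vs ! j)"
  | "gate_value T vs (Times js) = (\<Prod>j \<leftarrow> js. vs ! j)"

definition circuit_eval ::
    "'a gate list \<Rightarrow> (nat \<Rightarrow> ('v, 'a::comm_ring_1) mpoly) \<Rightarrow> ('v, 'a) mpoly"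
  where "circuit_eval C T = last (foldl (\<lambda>vs g. vs @ [gate_value T vs g]) [] C)"


section \<open>Immanants\<close>

text \<open>Characters with values in the multiplicative group of the complex numbers.\<close>

definition sym_characters :: "nat \<Rightarrow> ((nat \<Rightarrow> nat) \<Rightarrow> complex) set"
  where "sym_characters n = hom (sym_group n) (units_of (ring_of_type_algebra :: complex ring))"

text \<open>
  The values of a character of a symmetric group are integers, and this is how they
  are read as coefficients in an arbitrary field: \<open>char_coeff z\<close> is the image of the integer \<open>z\<close>.
\<close>

definition char_coeff :: "complex \<Rightarrow> 'a::ring_1"
  where "char_coeff z = of_int (THE k. of_int k = z)"

definition immanant ::
    "nat \<Rightarrow> ((nat \<Rightarrow> nat) \<Rightarrow> complex) \<Rightarrow> (nat \<times> nat, 'a::comm_ring_1) mpoly"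
  where "immanant n \<chi> =
    (\<Sum>\<sigma> \<in> carrier (sym_group n). Cst (char_coeff (\<chi> \<sigma>)) * (\<Prod>i = 1..n. Var (i, \<sigma> i)))"

end

theory Submission
  imports Defs "HOL-Library.Product_Lexorder"
begin

text \<open>
  If \<open>T\<^sub>i\<close> is not constant, substituting the zero of one of its linear factors for a variable
  annihilates \<open>T\<^sub>i\<close> and thereby lowers the transcendence degree of the family. So if that degree
  is \<open>k\<close>, at most \<open>k\<close> substitutions make every \<open>T\<^sub>i\<close>, and with them the value of the circuit,
  constant, while the other variables stay free. The immanant does not become constant:
  the substituted variables involve at most \<open>2 * k\<close> indices, and if \<open>4 * k \<le> n\<close> there is an
  involution \<open>\<sigma>\<close> mapping all these indices to other ones. Setting the free variables on the graph
  of \<open>\<sigma>\<close> to \<open>1\<close> and the remaining free ones to \<open>0\<close> gives the value \<open>\<chi> \<sigma> = \<plusminus>1\<close>, and setting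
  all free variables to \<open>0\<close> gives \<open>0\<close>.
\<close>

section \<open>Substitution homomorphisms\<close>

text \<open>The inner product of \<open>mpoly_subst\<close>, split off because it turns sums of
  exponent vectors into products.\<close>

definition monom_val :: "('v \<Rightarrow> 'b::comm_monoid_mult) \<Rightarrow> ('v \<Rightarrow>\<^sub>0 nat) \<Rightarrow> 'b"
  where "monom_val f \<mu> = (\<Prod>x \<in> Poly_Mapping.keys \<mu>. f x ^ Poly_Mapping.lookup \<mu> x)"

text \<open>Extra indices contribute zeroth powers. A common finite index set makes different
  monomials comparable.\<close>

lemma monom_val_superset:
  assumes "finite A" "Poly_Mapping.keys \<mu> \<subseteq> A"
  shows "monom_val f \<mu> = (\<Prod>x \<in> A. f x ^ Poly_Mapping.lookup \<mu> x)"
  unfolding monom_val_def using assms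
  by (intro prod.mono_neutral_left) (auto simp: in_keys_iff)

lemma monom_val_0 [simp]: "monom_val f 0 = 1"
  by (simp add: monom_val_def)

lemma monom_val_single [simp]: "monom_val f (Poly_Mapping.single x k) = f x ^ k"
  by (subst monom_val_superset[of "{x}"]) auto

lemma monom_val_add: "monom_val f (\<mu> + \<nu>) = monom_val f \<mu> * monom_val f \<nu>"
proof -
  let ?A = "Poly_Mapping.keys \<mu> \<union> Poly_Mapping.keys \<nu>"
  have "monom_val f (\<mu> + \<nu>) = (\<Prod>x \<in> ?A. f x ^ Poly_Mapping.lookup (\<mu> + \<nu>) x)"
    using Poly_Mapping.keys_add[of \<mu> \<nu>] by (intro monom_val_superset) auto
  also have "\<dots> = monom_val f \<mu> * monom_val f \<nu>"
    by (simp add: monom_val_superset[of ?A] lookup_add power_add prod.distrib)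
  finally show ?thesis .
qed

lemma poly_mapping_sum_single:
  "(\<Sum>k \<in> Poly_Mapping.keys p. Poly_Mapping.single k (Poly_Mapping.lookup p k)) = p"
proof (rule poly_mapping_eqI)
  fix k
  show "Poly_Mapping.lookup
      (\<Sum>k \<in> Poly_Mapping.keys p. Poly_Mapping.single k (Poly_Mapping.lookup p k)) k
    = Poly_Mapping.lookup p k"
    by (simp add: lookup_sum lookup_single when_def in_keys_iff)
qed

lemma Cst_0 [simp]: "Cst 0 = 0" and Cst_1 [simp]: "Cst 1 = 1"
  by (simp_all add: Cst_def)

lemma Cst_add: "Cst (a + b) = Cst a + Cst b"
  and Cst_mult: "Cst (a * b) = Cst a * Cst b"
  by (simp_all add: Cst_def single_add mult_single)

lemma Cst_uminus: "Cst (- a) = - Cst a"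
  by (simp add: Cst_def single_uminus)

lemma Cst_eq_iff [simp]: "Cst a = Cst b \<longleftrightarrow> a = b"
  unfolding Cst_def by (metis lookup_single_eq)

lemma Cst_eq_0_iff [simp]: "Cst a = 0 \<longleftrightarrow> a = 0"
  using Cst_eq_iff[of a 0] by (simp del: Cst_eq_iff)

lemma Cst_times_single: "Cst c * Poly_Mapping.single \<mu> a = Poly_Mapping.single \<mu> (c * a)"
  by (simp add: Cst_def mult_single)

lemma mpoly_subst_altdef:
  "mpoly_subst f p
    = (\<Sum>\<mu> \<in> Poly_Mapping.keys p. Cst (Poly_Mapping.lookup p \<mu>) * monom_val f \<mu>)"
  by (simp add: mpoly_subst_def monom_val_def)

lemma mpoly_subst_0 [simp]: "mpoly_subst f 0 = 0"
  by (simp add: mpoly_subst_altdef)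

lemma mpoly_subst_single:
  "mpoly_subst f (Poly_Mapping.single \<mu> c) = Cst c * monom_val f \<mu>"
  by (cases "c = 0") (simp_all add: mpoly_subst_altdef)

lemma mpoly_subst_Cst [simp]: "mpoly_subst f (Cst c) = Cst c"
  using mpoly_subst_single[of f 0 c] by (simp add: Cst_def)

lemma mpoly_subst_Var [simp]: "mpoly_subst f (Var x) = f x"
  by (simp add: Var_def mpoly_subst_single)

lemma mpoly_subst_add: "mpoly_subst f (p + q) = mpoly_subst f p + mpoly_subst f q"
  unfolding mpoly_subst_altdef
  by (rule setsum_keys_plus_distrib) (simp_all add: Cst_add algebra_simps)

lemma mpoly_subst_sum: "mpoly_subst f (\<Sum>i \<in> I. p i) = (\<Sum>i \<in> I. mpoly_subst f (p i))"
  by (induction I rule: infinite_finite_induct) (simp_all add: mpoly_subst_add)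

text \<open>Both factors are expanded into single monomials, where multiplicativity is
  \<open>monom_val_add\<close>.\<close>

lemma mpoly_subst_mult: "mpoly_subst f (p * q) = mpoly_subst f p * mpoly_subst f q"
proof -
  let ?s = "\<lambda>p \<mu>. Poly_Mapping.single \<mu> (Poly_Mapping.lookup p \<mu>)"
  have "mpoly_subst f (p * q)
    = mpoly_subst f ((\<Sum>\<mu> \<in> Poly_Mapping.keys p. ?s p \<mu>) * (\<Sum>\<nu> \<in> Poly_Mapping.keys q. ?s q \<nu>))"
    by (simp only: poly_mapping_sum_single)
  also have "\<dots> = (\<Sum>\<mu> \<in> Poly_Mapping.keys p. mpoly_subst f (?s p \<mu>))
      * (\<Sum>\<nu> \<in> Poly_Mapping.keys q. mpoly_subst f (?s q \<nu>))"
    by (simp add: sum_product mpoly_subst_sum mult_single mpoly_subst_single monom_val_add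
        Cst_mult mult_ac)
  also have "\<dots> = mpoly_subst f p * mpoly_subst f q"
    by (simp add: mpoly_subst_single flip: mpoly_subst_altdef)
  finally show ?thesis .
qed

section \<open>Algebra homomorphisms over the coefficient ring\<close>

definition alg_hom :: "(('v, 'a::comm_ring_1) mpoly \<Rightarrow> ('w, 'a) mpoly) \<Rightarrow> bool"
  where "alg_hom h \<longleftrightarrow> (\<forall>p q. h (p + q) = h p + h q) \<and> (\<forall>p q. h (p * q) = h p * h q)
    \<and> (\<forall>c. h (Cst c) = Cst c)"

lemma alg_hom_subst: "alg_hom (mpoly_subst f)"
  by (simp add: alg_hom_def mpoly_subst_add mpoly_subst_mult)

lemma alg_hom_id: "alg_hom (\<lambda>p. p)"
  by (simp add: alg_hom_def)

lemma alg_hom_comp: "alg_hom g \<Longrightarrow> alg_hom h \<Longrightarrow> alg_hom (\<lambda>p. g (h p))"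
  by (simp add: alg_hom_def)

context
  fixes h :: "('v, 'a::comm_ring_1) mpoly \<Rightarrow> ('w, 'a) mpoly"
  assumes hom: "alg_hom h"
begin

lemma alg_hom_add: "h (p + q) = h p + h q"
  and alg_hom_mult: "h (p * q) = h p * h q"
  and alg_hom_Cst: "h (Cst c) = Cst c"
  using hom by (simp_all add: alg_hom_def)

lemma alg_hom_0: "h 0 = 0" and alg_hom_1: "h 1 = 1"
  using alg_hom_Cst[of 0] alg_hom_Cst[of 1] by simp_all

lemma alg_hom_power: "h (p ^ k) = h p ^ k"
  by (induction k) (simp_all add: alg_hom_1 alg_hom_mult)

lemma alg_hom_sum: "h (\<Sum>i \<in> I. p i) = (\<Sum>i \<in> I. h (p i))"
  by (induction I rule: infinite_finite_induct) (simp_all add: alg_hom_0 alg_hom_add)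

lemma alg_hom_prod: "h (\<Prod>i \<in> I. p i) = (\<Prod>i \<in> I. h (p i))"
  by (induction I rule: infinite_finite_induct) (simp_all add: alg_hom_1 alg_hom_mult)

lemma alg_hom_prod_list: "h (prod_list ps) = prod_list (map h ps)"
  by (induction ps) (simp_all add: alg_hom_1 alg_hom_mult)

end

lemma Cst_sum_list: "Cst (sum_list cs) = sum_list (map Cst cs)"
  by (induction cs) (simp_all add: Cst_add)

lemma Cst_prod_list: "Cst (prod_list cs) = prod_list (map Cst cs)"
  by (induction cs) (simp_all add: Cst_mult)

lemma mpoly_subst_Var_id:
  fixes p :: "('v, 'a::comm_ring_1) mpoly"
  shows "mpoly_subst Var p = p"
proof -
  have "monom_val Var \<mu> = Poly_Mapping.single \<mu> (1::'a)" for \<mu> :: "'v \<Rightarrow>\<^sub>0 nat"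
  proof -
    have pow: "Var x ^ k = Poly_Mapping.single (Poly_Mapping.single x k) (1::'a)"
      for x :: 'v and k
      by (induction k) (simp_all add: Var_def mult_single flip: single_add)
    have "(\<Prod>x \<in> A. Var x ^ k x)
        = Poly_Mapping.single (\<Sum>x \<in> A. Poly_Mapping.single x (k x)) (1::'a)"
      if "finite A" for A :: "'v set" and k
      using that by induction (simp_all add: pow mult_single)
    then show ?thesis
      by (simp add: monom_val_def poly_mapping_sum_single)
  qed
  then show ?thesis
    by (simp add: mpoly_subst_altdef Cst_times_single poly_mapping_sum_single)
qed


section \<open>Transcendence degree of a homomorphic image\<close>

text \<open>A polynomial without variables is a constant, which substitution fixes. Hence the
  maximum in \<open>trdeg\<close> ranges over a nonempty set.\<close>

lemma alg_independent_empty: "alg_independent ({} :: ('v, 'a::field) mpoly set)"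
  unfolding alg_independent_def
proof safe
  fix q :: "(('v, 'a) mpoly, 'a) mpoly"
  assume vars: "mpoly_vars q \<subseteq> {}" and ev: "mpoly_subst (\<lambda>s. s) q = 0"
  have "Poly_Mapping.keys q \<subseteq> {0}"
    using vars by (auto simp: mpoly_vars_def)
  then have "q = Cst (Poly_Mapping.lookup q 0)"
    unfolding Cst_def
    by (intro poly_mapping_eqI) (auto simp: lookup_single when_def in_keys_iff)
  then obtain c where "q = Cst c" ..
  with ev show "q = 0"
    by simp
qed

lemma card_le_trdeg:
  assumes "finite S" "B \<subseteq> S" "alg_independent B"
  shows "card B \<le> trdeg S"
  unfolding trdeg_def using assms by (intro Max_ge) auto

lemma trdeg_attained:
  assumes "finite S"
  obtains B where "B \<subseteq> S" "alg_independent B" "card B = trdeg S"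
proof -
  have "trdeg S \<in> card ` {B. B \<subseteq> S \<and> alg_independent B}"
    unfolding trdeg_def using assms alg_independent_empty by (intro Max_in) auto
  then show ?thesis using that by auto
qed

lemma zero_notin_alg_independent:
  assumes "alg_independent B"
  shows "0 \<notin> B"
proof
  assume "0 \<in> B"
  then have "mpoly_vars (Var 0) \<subseteq> B"
    by (simp add: mpoly_vars_def Var_def)
  moreover have "mpoly_subst (\<lambda>s. s) (Var 0) = 0"
    by simp
  ultimately have "Var 0 = (0 :: (('a, 'b) mpoly, 'b) mpoly)"
    using assms unfolding alg_independent_def by blast
  then have "Poly_Mapping.lookup (Var 0 :: (('a, 'b) mpoly, 'b) mpoly) (Poly_Mapping.single 0 1) = 0"
    by simp
  then show False
    by (simp add: Var_def)
qed

text \<open>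
  In an annihilator of \<open>insert p B\<close>, cancel the highest common power of \<open>p\<close> and apply \<open>h\<close>: what
  survives is the part of lowest degree in \<open>p\<close>, an annihilator of \<open>h ` B\<close>.
\<close>

lemma alg_independent_insert_kernel:
  fixes h :: "('v::linorder, 'a::field) mpoly \<Rightarrow> ('w, 'a) mpoly"
  assumes hom: "alg_hom h" and fin: "finite B" and inj: "inj_on h B"
    and ind: "alg_independent (h ` B)" and p: "h p = 0" "p \<noteq> 0" "p \<notin> B"
  shows "alg_independent (insert p B)"
  unfolding alg_independent_def
proof (intro allI impI, elim conjE, rule ccontr)
  fix q :: "(('v, 'a) mpoly, 'a) mpoly"
  assume vars: "mpoly_vars q \<subseteq> insert p B" and ev: "mpoly_subst (\<lambda>s. s) q = 0" and "q \<noteq> 0"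
  let ?l = Poly_Mapping.lookup
  define K where "K = Poly_Mapping.keys q"
  define e where "e = Min ((\<lambda>\<mu>. ?l \<mu> p) ` K)"
  define K' where "K' = {\<mu> \<in> K. ?l \<mu> p = e}"
  have K: "finite K" "K \<noteq> {}"
    using \<open>q \<noteq> 0\<close> by (auto simp: K_def)
  have e_le: "e \<le> ?l \<mu> p" if "\<mu> \<in> K" for \<mu>
    unfolding e_def using K that by (intro Min_le) auto
  have e_less: "e < ?l \<mu> p" if "\<mu> \<in> K - K'" for \<mu>
    using that e_le[of \<mu>] by (auto simp: K'_def)
  have "e \<in> (\<lambda>\<mu>. ?l \<mu> p) ` K"
    unfolding e_def using K by (intro Min_in) auto
  then obtain \<mu>0 where \<mu>0: "\<mu>0 \<in> K'"
    by (auto simp: K'_def)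
  have keys: "Poly_Mapping.keys \<mu> \<subseteq> insert p B" if "\<mu> \<in> K" for \<mu>
    using vars that by (auto simp: mpoly_vars_def K_def)
  define r where "r = (\<Sum>\<mu> \<in> K. Cst (?l q \<mu>) * (p ^ (?l \<mu> p - e) * (\<Prod>x \<in> B. x ^ ?l \<mu> x)))"
  have "mpoly_subst (\<lambda>s. s) q
      = (\<Sum>\<mu> \<in> K. Cst (?l q \<mu>) * (p ^ ?l \<mu> p * (\<Prod>x \<in> B. x ^ ?l \<mu> x)))"
    unfolding mpoly_subst_altdef K_def[symmetric]
    using fin p by (intro sum.cong refl) (simp add: monom_val_superset[OF _ keys])
  also have "\<dots> = p ^ e * r"
    unfolding r_def sum_distrib_left
  proof (intro sum.cong refl)
    fix \<mu> assume "\<mu> \<in> K"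
    then have "p ^ ?l \<mu> p = p ^ e * p ^ (?l \<mu> p - e)"
      using e_le by (simp flip: power_add)
    then show "Cst (?l q \<mu>) * (p ^ ?l \<mu> p * (\<Prod>x \<in> B. x ^ ?l \<mu> x))
        = p ^ e * (Cst (?l q \<mu>) * (p ^ (?l \<mu> p - e) * (\<Prod>x \<in> B. x ^ ?l \<mu> x)))"
      by (simp add: mult_ac)
  qed
  \<comment> \<open>Cancelling \<open>p ^ e\<close> needs a ring without zero divisors; the linear
    order on the variables provides this through an order on monomials.\<close>
  finally have "r = 0"
    using ev p(2) by simp
  then have "0 = h r"
    by (simp add: alg_hom_0[OF hom])
  also have "h r = (\<Sum>\<mu> \<in> K. Cst (?l q \<mu>) * (0 ^ (?l \<mu> p - e) * (\<Prod>x \<in> B. h x ^ ?l \<mu> x)))"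
    unfolding r_def by (simp add: alg_hom_sum[OF hom] alg_hom_mult[OF hom] alg_hom_Cst[OF hom]
        alg_hom_power[OF hom] alg_hom_prod[OF hom] p(1))
  \<comment> \<open>The power of \<open>0\<close> is \<open>1\<close> when the exponent of
    \<open>p\<close> is exactly \<open>e\<close>, that is on \<open>K'\<close>, and \<open>0\<close>
    otherwise.\<close>
  also have "\<dots> = (\<Sum>\<mu> \<in> K'. Cst (?l q \<mu>) * (\<Prod>x \<in> B. h x ^ ?l \<mu> x))"
  proof (rule sum.mono_neutral_cong_right)
    show "\<forall>\<mu> \<in> K - K'. Cst (?l q \<mu>) * (0 ^ (?l \<mu> p - e) * (\<Prod>x \<in> B. h x ^ ?l \<mu> x)) = 0"
    proof
      fix \<mu> assume "\<mu> \<in> K - K'"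
      from e_less[OF this]
      show "Cst (?l q \<mu>) * (0 ^ (?l \<mu> p - e) * (\<Prod>x \<in> B. h x ^ ?l \<mu> x)) = 0"
        by (simp add: power_0_left)
    qed
  qed (use K in \<open>auto simp: K'_def\<close>)
  finally have h0: "(\<Sum>\<mu> \<in> K'. Cst (?l q \<mu>) * (\<Prod>x \<in> B. h x ^ ?l \<mu> x)) = 0" ..
  \<comment> \<open>\<open>\<nu>\<close> drops the variable \<open>p\<close> and renames each
    \<open>x\<close> in \<open>B\<close> to \<open>h x\<close>.\<close>
  define \<nu> where "\<nu> \<mu> = (\<Sum>x \<in> B. Poly_Mapping.single (h x) (?l \<mu> x))"
    for \<mu> :: "('v, 'a) mpoly \<Rightarrow>\<^sub>0 nat"
  have \<nu>_lookup: "?l (\<nu> \<mu>) (h x) = ?l \<mu> x" if "x \<in> B" for \<mu> x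
  proof -
    have "?l (\<nu> \<mu>) (h x) = (\<Sum>y \<in> B. if y = x then ?l \<mu> y else 0)"
      unfolding \<nu>_def lookup_sum
      using that inj by (intro sum.cong refl) (auto simp: lookup_single when_def inj_on_def)
    then show ?thesis
      using that fin by simp
  qed
  have \<nu>_keys: "Poly_Mapping.keys (\<nu> \<mu>) \<subseteq> h ` B" for \<mu>
    unfolding \<nu>_def by (rule order_trans[OF keys_sum]) auto
  \<comment> \<open>Dropping \<open>p\<close> loses nothing on \<open>K'\<close>, where its exponent
    is always \<open>e\<close>; so no other term can cancel the one of \<open>\<mu>0\<close> in
    \<open>q'\<close>.\<close>
  have \<nu>_inj: "\<mu> = \<mu>0" if "\<mu> \<in> K'" "\<nu> \<mu> = \<nu> \<mu>0" for \<mu>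
  proof (rule poly_mapping_eqI)
    fix x
    consider "x \<in> B" | "x = p" | "x \<notin> insert p B"
      by blast
    then show "?l \<mu> x = ?l \<mu>0 x"
    proof cases
      case 1
      then show ?thesis
        using that \<nu>_lookup by metis
    next
      case 2
      then show ?thesis
        using that \<mu>0 by (simp add: K'_def)
    next
      case 3
      then have "x \<notin> Poly_Mapping.keys \<mu>" "x \<notin> Poly_Mapping.keys \<mu>0"
        using keys that \<mu>0 by (auto simp: K'_def)
      then show ?thesis
        by (simp add: in_keys_iff)
    qed
  qed
  define q' where "q' = (\<Sum>\<mu> \<in> K'. Poly_Mapping.single (\<nu> \<mu>) (?l q \<mu>))"
  have "mpoly_vars q' \<subseteq> h ` B"
  proof -
    have "Poly_Mapping.keys q' \<subseteq> \<nu> ` K'"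
      unfolding q'_def by (rule order_trans[OF keys_sum]) auto
    then show ?thesis
      using \<nu>_keys by (fastforce simp: mpoly_vars_def)
  qed
  moreover have "mpoly_subst (\<lambda>s. s) q' = 0"
  proof -
    have "monom_val (\<lambda>s. s) (\<nu> \<mu>) = (\<Prod>x \<in> B. h x ^ ?l \<mu> x)" for \<mu>
      using fin inj
      by (subst monom_val_superset[OF _ \<nu>_keys]) (auto simp: prod.reindex \<nu>_lookup)
    then show ?thesis
      using h0 by (simp add: q'_def mpoly_subst_sum mpoly_subst_single)
  qed
  ultimately have "q' = 0"
    using ind unfolding alg_independent_def by blast
  have "?l q' (\<nu> \<mu>0) = (\<Sum>\<mu> \<in> K'. if \<mu> = \<mu>0 then ?l q \<mu> else 0)"
    unfolding q'_def lookup_sum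
    using \<nu>_inj by (intro sum.cong refl) (auto simp: lookup_single when_def)
  also have "\<dots> = ?l q \<mu>0"
    using \<mu>0 K by (simp add: K'_def)
  also have "\<dots> \<noteq> 0"
    using \<mu>0 by (simp add: K'_def K_def in_keys_iff)
  finally show False
    using \<open>q' = 0\<close> by simp
qed

text \<open>A largest independent subset of the image lifts to a set \<open>B\<close> on which
  \<open>h\<close> is injective. It omits \<open>p\<close>, since \<open>h p = 0\<close> lies in no
  independent set, and adding \<open>p\<close> to it preserves independence.\<close>

lemma trdeg_image_less:
  fixes h :: "('v::linorder, 'a::field) mpoly \<Rightarrow> ('w, 'a) mpoly"
  assumes hom: "alg_hom h" and fin: "finite S" and p: "p \<in> S" "h p = 0" "p \<noteq> 0"
  shows "trdeg (h ` S) < trdeg S"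
proof -
  obtain B' where B': "B' \<subseteq> h ` S" "alg_independent B'" "card B' = trdeg (h ` S)"
    using trdeg_attained fin by (metis finite_imageI)
  obtain B where B: "B \<subseteq> S" "inj_on h B" "B' = h ` B"
    using B'(1) by (metis subset_image_inj)
  have finB: "finite B"
    using B fin finite_subset by blast
  have "p \<notin> B"
    using zero_notin_alg_independent[OF B'(2)] B p by force
  then have "alg_independent (insert p B)"
    using alg_independent_insert_kernel[OF hom finB B(2)] B' B p by simp
  then have "card (insert p B) \<le> trdeg S"
    using B p fin by (intro card_le_trdeg) auto
  moreover have "card B = trdeg (h ` S)"
    using B' B by (simp add: card_image)
  ultimately show ?thesis
    using \<open>p \<notin> B\<close> finB by simp
qed

section \<open>Making products of linear polynomials constant\<close>

text \<open>The analogue of \<open>product_of_linear\<close> over an arbitrary type of variables, a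
  class closed under substitution of linear polynomials.\<close>

definition linear_product :: "('v, 'a::comm_ring_1) mpoly \<Rightarrow> bool"
  where "linear_product p \<longleftrightarrow> (\<exists>ls. (\<forall>l \<in> set ls. linear_mpoly l) \<and> p = prod_list ls)"

lemma linear_mpoly_Cst [simp]: "linear_mpoly (Cst c)"
  by (simp add: linear_mpoly_def Cst_def monom_degree_def)

lemma linear_mpoly_Var [simp]: "linear_mpoly (Var x)"
  by (simp add: linear_mpoly_def Var_def monom_degree_def)

lemma linear_mpoly_add: "linear_mpoly p \<Longrightarrow> linear_mpoly q \<Longrightarrow> linear_mpoly (p + q)"
  using Poly_Mapping.keys_add[of p q] by (auto simp: linear_mpoly_def)

lemma linear_mpoly_sum: "(\<And>i. i \<in> I \<Longrightarrow> linear_mpoly (p i)) \<Longrightarrow> linear_mpoly (\<Sum>i \<in> I. p i)"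
  by (induction I rule: infinite_finite_induct)
    (auto simp: linear_mpoly_add, simp_all add: linear_mpoly_def)

lemma linear_mpoly_scale: "linear_mpoly p \<Longrightarrow> linear_mpoly (Cst c * p)"
proof -
  assume "linear_mpoly p"
  moreover have "Poly_Mapping.keys (Cst c * p) \<subseteq> Poly_Mapping.keys p"
    using Poly_Mapping.keys_mult[of "Cst c" p] by (auto simp: Cst_def split: if_splits)
  ultimately show ?thesis
    by (auto simp: linear_mpoly_def)
qed

text \<open>A variable with positive exponent uses up the whole degree.\<close>

lemma monom_degree_le_1:
  assumes "monom_degree \<mu> \<le> 1"
  shows "\<mu> = 0 \<or> (\<exists>x. \<mu> = Poly_Mapping.single x 1)"
proof (cases "\<mu> = 0")
  case False
  then have "Poly_Mapping.keys \<mu> \<noteq> {}"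
    by simp
  then obtain x where x: "x \<in> Poly_Mapping.keys \<mu>"
    by blast
  have "Poly_Mapping.lookup \<mu> x
      + (\<Sum>y \<in> Poly_Mapping.keys \<mu> - {x}. Poly_Mapping.lookup \<mu> y) \<le> 1"
    using assms x by (simp add: monom_degree_def sum.remove)
  moreover have "Poly_Mapping.lookup \<mu> x \<ge> 1"
    using x by (simp add: in_keys_iff)
  ultimately have "Poly_Mapping.lookup \<mu> x = 1"
    and "(\<Sum>y \<in> Poly_Mapping.keys \<mu> - {x}. Poly_Mapping.lookup \<mu> y) = 0"
    by linarith+
  then have "\<mu> = Poly_Mapping.single x 1"
    by (intro poly_mapping_eqI) (auto simp: lookup_single when_def in_keys_iff)
  then show ?thesis
    by blast
qed simp

lemma linear_mpoly_subst:
  fixes f :: "'v \<Rightarrow> ('b, 'a::comm_ring_1) mpoly"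
  assumes f: "\<And>x. linear_mpoly (f x)" and p: "linear_mpoly p"
  shows "linear_mpoly (mpoly_subst f p)"
  unfolding mpoly_subst_altdef
proof (intro linear_mpoly_sum linear_mpoly_scale)
  fix \<mu> assume "\<mu> \<in> Poly_Mapping.keys p"
  then have "\<mu> = 0 \<or> (\<exists>x. \<mu> = Poly_Mapping.single x 1)"
    using p by (intro monom_degree_le_1) (simp add: linear_mpoly_def)
  moreover have "linear_mpoly (1 :: ('b, 'a) mpoly)"
    using linear_mpoly_Cst[of 1] by simp
  ultimately show "linear_mpoly (monom_val f \<mu>)"
    using f by auto
qed

lemma linear_product_subst:
  assumes f: "\<And>x. linear_mpoly (f x)" and p: "linear_product p"
  shows "linear_product (mpoly_subst f p)"
proof -
  obtain ls where ls: "\<forall>l \<in> set ls. linear_mpoly l" "p = prod_list ls"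
    using p by (auto simp: linear_product_def)
  then have "\<forall>l \<in> set (map (mpoly_subst f) ls). linear_mpoly l"
    using f by (auto intro: linear_mpoly_subst)
  then show ?thesis
    unfolding linear_product_def ls(2) alg_hom_prod_list[OF alg_hom_subst] by blast
qed

text \<open>
  Solving \<open>l = 0\<close> for a variable \<open>x\<close> that occurs in \<open>l\<close> with coefficient \<open>a\<close> means substituting
  \<open>x - l / a\<close> for \<open>x\<close>.
\<close>

lemma linear_mpoly_kill:
  fixes l :: "('v, 'a::field) mpoly"
  assumes lin: "linear_mpoly l" and nconst: "\<nexists>c. l = Cst c"
  obtains x g where "linear_mpoly g" "mpoly_subst (Var(x := g)) l = 0"
proof -
  have "\<exists>\<mu> \<in> Poly_Mapping.keys l. \<mu> \<noteq> 0"
  proof (rule ccontr)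
    assume "\<not> ?thesis"
    then have "l = Cst (Poly_Mapping.lookup l 0)"
      unfolding Cst_def
      by (intro poly_mapping_eqI) (auto simp: lookup_single when_def in_keys_iff)
    then show False
      using nconst by blast
  qed
  then obtain x where x: "Poly_Mapping.single x 1 \<in> Poly_Mapping.keys l"
    using lin by (metis linear_mpoly_def monom_degree_le_1)
  define a where "a = Poly_Mapping.lookup l (Poly_Mapping.single x 1)"
  have a: "a \<noteq> 0"
    using x by (simp add: a_def in_keys_iff)
  define g where "g = Var x + Cst (- 1 / a) * l"
  let ?f = "Var(x := g)"
  let ?c = "\<lambda>\<mu>. Cst (Poly_Mapping.lookup l \<mu>)"
  let ?K = "Poly_Mapping.keys l - {Poly_Mapping.single x 1}"
  have split: "mpoly_subst f l = Cst a * f x + (\<Sum>\<mu> \<in> ?K. ?c \<mu> * monom_val f \<mu>)"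
    for f :: "'v \<Rightarrow> ('v, 'a) mpoly"
    using x by (simp add: mpoly_subst_altdef sum.remove a_def)
  \<comment> \<open>The other monomials of \<open>l\<close> are \<open>1\<close> or a variable
    different from \<open>x\<close>, so the substitution leaves them alone.\<close>
  have "(\<Sum>\<mu> \<in> ?K. ?c \<mu> * monom_val ?f \<mu>) = (\<Sum>\<mu> \<in> ?K. ?c \<mu> * monom_val Var \<mu>)"
  proof (intro sum.cong refl arg_cong[where f = "(*) _"])
    fix \<mu> assume \<mu>: "\<mu> \<in> ?K"
    then have "\<mu> = 0 \<or> (\<exists>x. \<mu> = Poly_Mapping.single x 1)"
      using lin by (intro monom_degree_le_1) (simp add: linear_mpoly_def)
    then show "monom_val ?f \<mu> = monom_val Var \<mu>"
      using \<mu> by auto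
  qed
  \<comment> \<open>Comparison with the identity substitution: \<open>l\<close> changes by
    \<open>a * (g - x)\<close>, which is \<open>- l\<close>.\<close>
  then have "mpoly_subst ?f l - mpoly_subst Var l = Cst a * (g - Var x)"
    by (simp add: split algebra_simps)
  also have "\<dots> = Cst (a * (- 1 / a)) * l"
    by (simp only: g_def Cst_mult add_diff_cancel_left' mult.assoc)
  also have "a * (- 1 / a) = - 1"
    using a by simp
  also have "Cst (- 1) * l = - l"
    by (simp add: Cst_uminus)
  finally have "mpoly_subst ?f l = 0"
    by (simp only: mpoly_subst_Var_id diff_eq_eq left_minus)
  moreover have "linear_mpoly g"
    unfolding g_def using lin by (intro linear_mpoly_add linear_mpoly_scale) simp_all
  ultimately show ?thesis
    using that by blast
qed

text \<open>Some factor is not constant, and annihilating it annihilates the product.\<close>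

lemma linear_product_kill:
  fixes p :: "('v, 'a::field) mpoly"
  assumes "linear_product p" and nconst: "\<nexists>c. p = Cst c"
  obtains x g where "linear_mpoly g" "mpoly_subst (Var(x := g)) p = 0"
proof -
  obtain ls where ls: "\<forall>l \<in> set ls. linear_mpoly l" "p = prod_list ls"
    using assms by (auto simp: linear_product_def)
  have "\<exists>l \<in> set ls. \<nexists>c. l = Cst c"
  proof (rule ccontr)
    assume "\<not> ?thesis"
    then have "\<forall>l \<in> set ls. \<exists>c. l = Cst c"
      by blast
    then obtain c where "\<forall>l \<in> set ls. l = Cst (c l)"
      by metis
    then have "map Cst (map c ls) = ls"
      by (simp add: map_idI)
    then have "p = Cst (prod_list (map c ls))"
      by (simp add: Cst_prod_list ls(2))
    with nconst show False
      by blast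
  qed
  then obtain l where l: "l \<in> set ls" "\<nexists>c. l = Cst c"
    by blast
  obtain x g where xg: "linear_mpoly g" "mpoly_subst (Var(x := g)) l = 0"
    by (rule linear_mpoly_kill[OF bspec[OF ls(1) l(1)] l(2)])
  have "l dvd p"
    unfolding ls(2) using l(1) by (induction ls) auto
  then obtain r where "p = l * r" ..
  then have "mpoly_subst (Var(x := g)) p = 0"
    using xg(2) by (simp add: mpoly_subst_mult)
  with xg(1) show ?thesis
    using that by blast
qed

text \<open>Induction on the transcendence degree: each substitution kills one nonconstant member
  and strictly lowers the degree, which pays for the one variable added to \<open>P\<close>. The
  images are again products of linear polynomials.\<close>

lemma linear_products_constant:
  fixes S :: "('v::linorder, 'a::field) mpoly set"
  assumes "finite S" "\<And>p. p \<in> S \<Longrightarrow> linear_product p"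
  shows "\<exists>(h :: ('v, 'a) mpoly \<Rightarrow> ('v, 'a) mpoly) P. alg_hom h \<and> finite P \<and> card P \<le> trdeg S \<and>
    (\<forall>x. x \<notin> P \<longrightarrow> h (Var x) = Var x) \<and> (\<forall>p \<in> S. \<exists>c. h p = Cst c)"
  using assms
proof (induction "trdeg S" arbitrary: S rule: less_induct)
  case less
  show ?case
  proof (cases "\<forall>p \<in> S. \<exists>c. p = Cst c")
    case True
    then show ?thesis
      by (intro exI[of _ "\<lambda>p. p"] exI[of _ "{}"]) (simp add: alg_hom_id)
  next
    case False
    then obtain p where p: "p \<in> S" "\<nexists>c. p = Cst c"
      by blast
    obtain x g where xg: "linear_mpoly g" "mpoly_subst (Var(x := g)) p = 0"
      by (rule linear_product_kill[OF less.prems(2)[OF p(1)] p(2)])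
    let ?h = "mpoly_subst (Var(x := g))"
    have "p \<noteq> 0"
      using p(2) Cst_0 by metis
    then have less_trdeg: "trdeg (?h ` S) < trdeg S"
      by (rule trdeg_image_less[OF alg_hom_subst less.prems(1) p(1) xg(2)])
    have "linear_product q" if "q \<in> ?h ` S" for q
      using that less.prems(2) xg(1) by (auto intro!: linear_product_subst)
    from less.hyps[OF less_trdeg finite_imageI[OF less.prems(1)] this]
    obtain h :: "('v, 'a) mpoly \<Rightarrow> ('v, 'a) mpoly" and P
      where h: "alg_hom h" "finite P" "card P \<le> trdeg (?h ` S)"
        "\<forall>y. y \<notin> P \<longrightarrow> h (Var y) = Var y" "\<forall>q \<in> ?h ` S. \<exists>c. h q = Cst c"
      by blast
    show ?thesis
    proof (intro exI[of _ "\<lambda>q. h (?h q)"] exI[of _ "insert x P"] conjI)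
      show "card (insert x P) \<le> trdeg S"
        using h(2,3) less_trdeg by (simp add: card_insert_if)
    qed (use h alg_hom_comp[OF h(1) alg_hom_subst] in auto)
  qed
qed


section \<open>Circuits with constant inputs\<close>

text \<open>Constants are closed under sums and products, and \<open>h\<close> commutes with
  both.\<close>

lemma gate_value_constant:
  assumes hom: "alg_hom h" and T: "\<And>i. i \<in> {1..m} \<Longrightarrow> \<exists>c. h (T i) = Cst c"
    and vs: "\<And>v. v \<in> set vs \<Longrightarrow> \<exists>c. h v = Cst c" and wf: "wf_gate m (length vs) g"
  shows "\<exists>c. h (gate_value T vs g) = Cst c"
proof -
  have "\<exists>c. \<forall>v \<in> set vs. h v = Cst (c v)"
    using vs by metis
  then obtain c where c: "\<And>v. v \<in> set vs \<Longrightarrow> h v = Cst (c v)"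
    by blast
  have args: "map (\<lambda>j. h (vs ! j)) js = map Cst (map (\<lambda>j. c (vs ! j)) js)"
    if "\<forall>j \<in> set js. j < length vs" for js
    using that c by simp
  show ?thesis
  proof (cases g)
    case (Input i)
    then show ?thesis
      using T wf by simp
  next
    case (Const a)
    then show ?thesis
      using alg_hom_Cst[OF hom] by auto
  next
    case (Plus js)
    have "h (sum_list ps) = sum_list (map h ps)" for ps
      by (induction ps) (simp_all add: alg_hom_0[OF hom] alg_hom_add[OF hom])
    then have "h (gate_value T vs g) = sum_list (map (\<lambda>j. h (vs ! j)) js)"
      using Plus by (simp add: comp_def)
    also have "\<dots> = Cst (sum_list (map (\<lambda>j. c (vs ! j)) js))"
      using args wf Plus by (simp only: Cst_sum_list wf_gate.simps)
    finally show ?thesis ..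
  next
    case (Times js)
    have "h (gate_value T vs g) = prod_list (map (\<lambda>j. h (vs ! j)) js)"
      using Times by (simp add: alg_hom_prod_list[OF hom] comp_def)
    also have "\<dots> = Cst (prod_list (map (\<lambda>j. c (vs ! j)) js))"
      using args wf Times by (simp only: Cst_prod_list wf_gate.simps)
    finally show ?thesis ..
  qed
qed

text \<open>Induction on the gate list from its end, matching the way values are appended. The
  length claim ensures that gate arguments point to values already known to become constant.\<close>

lemma circuit_eval_constant:
  assumes hom: "alg_hom h" and T: "\<And>i. i \<in> {1..m} \<Longrightarrow> \<exists>c. h (T i) = Cst c"
    and C: "arith_circuit m C"
  shows "\<exists>c. h (circuit_eval C T) = Cst c"
proof -
  let ?vals = "foldl (\<lambda>vs g. vs @ [gate_value T vs g]) []"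
  have "length (?vals D) = length D \<and> (\<forall>v \<in> set (?vals D). \<exists>c. h v = Cst c)"
    if "\<forall>k < length D. wf_gate m k (D ! k)" for D
    using that
  proof (induction D rule: rev_induct)
    case (snoc g D)
    have "\<forall>k < length D. wf_gate m k (D ! k)"
      using snoc.prems by (auto simp: nth_append less_Suc_eq split: if_splits)
    with snoc.IH have IH: "length (?vals D) = length D" "\<forall>v \<in> set (?vals D). \<exists>c. h v = Cst c"
      by blast+
    have "wf_gate m (length D) g"
      using snoc.prems by (auto simp: nth_append)
    then have "\<exists>c. h (gate_value T (?vals D) g) = Cst c"
      using IH by (intro gate_value_constant[OF hom T]) auto
    with IH show ?case
      by auto
  qed simp
  then have "length (?vals C) = length C" "\<forall>v \<in> set (?vals C). \<exists>c. h v = Cst c"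
    using C by (auto simp: arith_circuit_def)
  moreover have "?vals C \<noteq> []"
    using \<open>length (?vals C) = length C\<close> C by (auto simp: arith_circuit_def)
  ultimately show ?thesis
    unfolding circuit_eval_def using last_in_set by blast
qed


section \<open>Immanants are not constant on large coordinate subspaces\<close>

text \<open>\<open>\<chi> id\<close> is an idempotent unit, hence \<open>1\<close>, and
  \<open>\<chi> \<sigma>\<close> squares to it.\<close>

lemma sym_character_involution:
  assumes "\<chi> \<in> sym_characters n" "\<sigma> permutes {1..n}" "\<sigma> \<circ> \<sigma> = id"
  shows "\<chi> \<sigma> = 1 \<or> \<chi> \<sigma> = -1"
proof -
  have id: "id \<in> carrier (sym_group n)" and \<sigma>: "\<sigma> \<in> carrier (sym_group n)"
    using assms(2) by (simp_all add: sym_group_carrier permutes_id)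
  have mult: "\<chi> (\<alpha> \<circ> \<beta>) = \<chi> \<alpha> * \<chi> \<beta>"
    if "\<alpha> \<in> carrier (sym_group n)" "\<beta> \<in> carrier (sym_group n)" for \<alpha> \<beta>
    using assms(1) that
    by (simp add: sym_characters_def hom_def sym_group_mult units_of_def ring_of_type_algebra_def)
  have "\<chi> id \<in> Units (ring_of_type_algebra :: complex ring)"
    using assms(1) id by (auto simp: sym_characters_def hom_def units_of_def)
  then have "\<chi> id \<noteq> 0"
    by (auto simp: Units_def ring_of_type_algebra_def)
  then have "\<chi> id = 1"
    using mult[OF id id] by simp
  then have "\<chi> \<sigma> * \<chi> \<sigma> = 1"
    using mult[OF \<sigma> \<sigma>] assms(3) by simp
  then show ?thesis
    by (simp add: square_eq_1_iff)
qed

lemma char_coeff_of_int: "char_coeff (of_int k) = of_int k"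
  by (simp add: char_coeff_def)

lemma char_coeff_involution_nonzero:
  assumes "\<chi> \<in> sym_characters n" "\<sigma> permutes {1..n}" "\<sigma> \<circ> \<sigma> = id"
  shows "char_coeff (\<chi> \<sigma>) \<noteq> (0 :: 'a::ring_1)"
  using sym_character_involution[OF assms] char_coeff_of_int[of 1, where 'a = 'a]
    char_coeff_of_int[of "-1", where 'a = 'a]
  by auto

text \<open>The complement of \<open>S\<close> is at least as large as \<open>S\<close>, so some
  \<open>g\<close> injects \<open>S\<close> into it; \<open>\<sigma>\<close> swaps each
  \<open>i\<close> in \<open>S\<close> with \<open>g i\<close> and fixes everything else.\<close>

lemma involution_moving_out:
  assumes S: "S \<subseteq> {1..n}" "2 * card S \<le> n"
  obtains \<sigma> where "\<sigma> permutes {1..n}" "\<sigma> \<circ> \<sigma> = id" "\<And>i. i \<in> S \<Longrightarrow> \<sigma> i \<notin> S"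
proof -
  have finS: "finite S"
    using S(1) finite_subset by blast
  then have "card S \<le> card ({1..n} - S)"
    using S by (simp add: card_Diff_subset)
  then obtain g where g: "g ` S \<subseteq> {1..n} - S" "inj_on g S"
    using finS by (metis card_le_inj finite_Diff finite_atLeastAtMost)
  define \<sigma> where
    "\<sigma> i = (if i \<in> S then g i else if i \<in> g ` S then the_inv_into S g i else i)" for i
  have inv: "\<sigma> (\<sigma> i) = i" for i
    using g the_inv_into_into[OF g(2), of i S]
    by (auto simp: \<sigma>_def the_inv_into_f_f[OF g(2)])
  have "\<sigma> permutes {1..n}"
    unfolding permutes_def
  proof (intro conjI allI impI)
    show "\<sigma> i = i" if "i \<notin> {1..n}" for i
      using that S(1) g(1) by (auto simp: \<sigma>_def)
    show "\<exists>!i. \<sigma> i = j" for j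
      using inv by metis
  qed
  moreover have "\<sigma> i \<notin> S" if "i \<in> S" for i
    using that g(1) by (auto simp: \<sigma>_def)
  ultimately show ?thesis
    using that inv by (metis comp_apply eq_id_iff)
qed

text \<open>If \<open>\<tau>\<close> sent some \<open>i\<close> in \<open>S\<close> into
  \<open>S\<close>, then \<open>\<sigma> (\<tau> i)\<close> would lie outside \<open>S\<close>,
  where \<open>\<tau>\<close> follows \<open>\<sigma>\<close> and so takes it to
  \<open>\<tau> i\<close> as well. This contradicts injectivity, so uncontrolled entries in
  \<open>S \<times> S\<close> admit no second permutation.\<close>

lemma permutes_eq_involution:
  assumes \<sigma>: "\<sigma> permutes A" "\<sigma> \<circ> \<sigma> = id" "\<And>i. i \<in> S \<Longrightarrow> \<sigma> i \<notin> S"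
    and \<tau>: "\<tau> permutes A" "\<And>i. i \<in> A \<Longrightarrow> \<tau> i = \<sigma> i \<or> i \<in> S \<and> \<tau> i \<in> S"
  shows "\<tau> = \<sigma>"
proof
  fix i
  show "\<tau> i = \<sigma> i"
  proof (cases "i \<in> A")
    case True
    have False if "i \<in> S" "\<tau> i \<in> S"
    proof -
      let ?j = "\<sigma> (\<tau> i)"
      have "?j \<notin> S"
        using \<sigma>(3) that(2) by blast
      moreover have "?j \<in> A"
        using True \<sigma>(1) \<tau>(1) by (simp add: permutes_in_image)
      ultimately have "\<tau> ?j = \<sigma> ?j"
        using \<tau>(2) by blast
      also have "\<dots> = \<tau> i"
        using \<sigma>(2) by (metis comp_apply id_apply)
      finally have "?j = i"
        using permutes_inj[OF \<tau>(1)] by (simp add: inj_eq)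
      then show False
        using \<open>?j \<notin> S\<close> that(1) by simp
    qed
    then show ?thesis
      using \<tau>(2)[OF True] by blast
  next
    case False
    then show ?thesis
      using \<sigma>(1) \<tau>(1) by (simp add: permutes_not_in)
  qed
qed

text \<open>
  Put \<open>t\<close> on the graph of an involution \<open>\<sigma>\<close> and \<open>0\<close> on the other entries outside \<open>P\<close>. If \<open>\<sigma>\<close> moves
  the indices of \<open>P\<close> out of themselves, only \<open>\<sigma>\<close> contributes to the immanant, whatever the
  entries in \<open>P\<close> are, and its value is \<open>t ^ n * \<chi> \<sigma>\<close>.
\<close>

lemma immanant_not_constant:
  fixes h :: "(nat \<times> nat, 'a::field) mpoly \<Rightarrow> (nat \<times> nat, 'a) mpoly"
  assumes \<chi>: "\<chi> \<in> sym_characters n" and hom: "alg_hom h"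
    and P: "finite P" "4 * card P \<le> n" "\<And>x. x \<notin> P \<Longrightarrow> h (Var x) = Var x" and n: "n > 0"
  shows "h (immanant n \<chi>) \<noteq> Cst c"
proof
  assume const: "h (immanant n \<chi>) = Cst c"
  define S where "S = (fst ` P \<union> snd ` P) \<inter> {1..n}"
  have "card S \<le> card (fst ` P \<union> snd ` P)"
    unfolding S_def using P(1) by (intro card_mono) auto
  also have "\<dots> \<le> card P + card P"
    using card_Un_le[of "fst ` P" "snd ` P"] card_image_le[OF P(1), of fst]
      card_image_le[OF P(1), of snd] by linarith
  finally have cardS: "2 * card S \<le> n"
    using P(2) by linarith
  \<comment> \<open>\<open>S\<close> collects the row and column indices of \<open>P\<close>, so
    only the block \<open>S \<times> S\<close> can contain entries altered by
    \<open>h\<close>.\<close>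
  have notP: "(i, j) \<notin> P" if "i \<in> {1..n}" "j \<in> {1..n}" "\<not> (i \<in> S \<and> j \<in> S)" for i j
    using that by (force simp: S_def)
  obtain \<sigma> where \<sigma>: "\<sigma> permutes {1..n}" "\<sigma> \<circ> \<sigma> = id" "\<And>i. i \<in> S \<Longrightarrow> \<sigma> i \<notin> S"
    using involution_moving_out[of S n] cardS by (auto simp: S_def)
  define e :: "'a \<Rightarrow> (nat \<times> nat, 'a) mpoly \<Rightarrow> (nat \<times> nat, 'a) mpoly"
    where "e t = mpoly_subst (\<lambda>(i, j). Cst (if j = \<sigma> i then t else 0))" for t
  have hom_e: "alg_hom (\<lambda>p. e t (h p))" for t
    unfolding e_def by (rule alg_hom_comp[OF alg_hom_subst hom])
  have entry: "e t (h (Var (i, \<tau> i))) = Cst (if \<tau> i = \<sigma> i then t else 0)"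
    if "\<tau> permutes {1..n}" "i \<in> {1..n}" "\<not> (i \<in> S \<and> \<tau> i \<in> S)" for t \<tau> i
  proof -
    have "\<tau> i \<in> {1..n}"
      using permutes_in_image[OF that(1)] that(2) by blast
    then have "(i, \<tau> i) \<notin> P"
      using notP that(2,3) by blast
    then show ?thesis
      by (simp add: P(3) e_def)
  qed
  let ?term = "\<lambda>t \<tau>. Cst (char_coeff (\<chi> \<tau>)) * (\<Prod>i = 1..n. e t (h (Var (i, \<tau> i))))"
  let ?G = "carrier (sym_group n)"
  \<comment> \<open>The same constant \<open>c\<close> results for every \<open>t\<close>; the
    values \<open>0\<close> and \<open>1\<close> of \<open>t\<close> will give different
    answers.\<close>
  have "Cst c = e t (h (immanant n \<chi>))" for t
    by (simp add: const e_def)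
  also have "e t (h (immanant n \<chi>)) = (\<Sum>\<tau> \<in> ?G. ?term t \<tau>)" for t
    unfolding immanant_def
    by (simp add: alg_hom_sum[OF hom_e] alg_hom_mult[OF hom_e] alg_hom_prod[OF hom_e]
        alg_hom_Cst[OF hom_e])
  finally have eval: "Cst c = (\<Sum>\<tau> \<in> ?G. ?term t \<tau>)" for t .
  have fin: "finite ?G"
    by (simp add: sym_group_def finite_permutations)
  \<comment> \<open>As \<open>S\<close> is at most half of the nonempty range, some row lies outside
    \<open>S\<close>, and for \<open>t = 0\<close> its entry vanishes.\<close>
  have "?term 0 \<tau> = 0" if "\<tau> \<in> ?G" for \<tau>
  proof -
    have "S \<noteq> {1..n}"
      using cardS n by auto
    then obtain i where i: "i \<in> {1..n}" "i \<notin> S"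
      unfolding S_def by blast
    then have "e 0 (h (Var (i, \<tau> i))) = 0"
      using entry[of \<tau> i 0] that by (simp add: sym_group_carrier)
    then have "(\<Prod>i = 1..n. e 0 (h (Var (i, \<tau> i)))) = 0"
      using i(1) by (intro prod_zero) auto
    then show ?thesis
      by simp
  qed
  then have "(\<Sum>\<tau> \<in> ?G. ?term 0 \<tau>) = 0"
    by (intro sum.neutral) blast
  from trans[OF eval this] have "c = 0"
    by simp
  have "?term 1 \<tau> = 0" if "\<tau> \<in> ?G - {\<sigma>}" for \<tau>
  proof -
    have \<tau>: "\<tau> permutes {1..n}" "\<tau> \<noteq> \<sigma>"
      using that by (simp_all add: sym_group_carrier)
    then obtain i where i: "i \<in> {1..n}" "\<tau> i \<noteq> \<sigma> i" "\<not> (i \<in> S \<and> \<tau> i \<in> S)"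
      using permutes_eq_involution[OF \<sigma> \<tau>(1)] by blast
    then have "e 1 (h (Var (i, \<tau> i))) = 0"
      using entry[OF \<tau>(1), of i 1] by simp
    then have "(\<Prod>i = 1..n. e 1 (h (Var (i, \<tau> i)))) = 0"
      using i(1) by (intro prod_zero) auto
    then show ?thesis
      by simp
  qed
  then have "(\<Sum>\<tau> \<in> ?G - {\<sigma>}. ?term 1 \<tau>) = 0"
    by (intro sum.neutral) blast
  then have "(\<Sum>\<tau> \<in> ?G. ?term 1 \<tau>) = ?term 1 \<sigma>"
    using sum.remove[OF fin, of \<sigma> "?term 1"] \<sigma>(1) by (simp add: sym_group_carrier)
  \<comment> \<open>The graph of \<open>\<sigma>\<close> avoids \<open>S \<times> S\<close>, so each
    of its entries evaluates to \<open>t = 1\<close>.\<close>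
  also have "(\<Prod>i = 1..n. e 1 (h (Var (i, \<sigma> i)))) = 1"
    using entry[OF \<sigma>(1), of _ 1] \<sigma>(3) by (intro prod.neutral) auto
  finally have "(\<Sum>\<tau> \<in> ?G. ?term 1 \<tau>) = Cst (char_coeff (\<chi> \<sigma>))"
    by simp
  from trans[OF eval this] have "c = char_coeff (\<chi> \<sigma>)"
    by simp
  then show False
    using \<open>c = 0\<close> char_coeff_involution_nonzero[OF \<chi> \<sigma>(1,2), where 'a = 'a] by simp
qed

section \<open>The linear lower bound on the transcendence degree\<close>

theorem theorem1p8:
  shows "\<exists>c::real. c > 0 \<and> (\<exists>n\<^sub>0. \<forall>n \<ge> n\<^sub>0.
    \<forall>\<chi> \<in> sym_characters n.
    \<forall>m (T :: nat \<Rightarrow> (nat \<times> nat, 'a::field_char_0) mpoly) (C :: 'a gate list).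
      (\<forall>i \<in> {1..m}. product_of_linear n (T i)) \<longrightarrow>
      arith_circuit m C \<longrightarrow>
      circuit_eval C T = immanant n \<chi> \<longrightarrow>
      real (trdeg (T ` {1..m})) \<ge> c * real n)"
proof (rule exI[of _ "1 / 4"], rule conjI)
  show "\<exists>n\<^sub>0. \<forall>n \<ge> n\<^sub>0. \<forall>\<chi> \<in> sym_characters n.
    \<forall>m (T :: nat \<Rightarrow> (nat \<times> nat, 'a::field_char_0) mpoly) (C :: 'a gate list).
      (\<forall>i \<in> {1..m}. product_of_linear n (T i)) \<longrightarrow> arith_circuit m C \<longrightarrow>
      circuit_eval C T = immanant n \<chi> \<longrightarrow> real (trdeg (T ` {1..m})) \<ge> 1 / 4 * real n"
  \<comment> \<open>The threshold \<open>1\<close> excludes \<open>n = 0\<close>, where the immanant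
    is itself a constant.\<close>
  proof (rule exI[of _ 1], intro allI ballI impI)
    fix n m \<chi> and T :: "nat \<Rightarrow> (nat \<times> nat, 'a) mpoly" and C :: "'a gate list"
    assume n: "1 \<le> n" and \<chi>: "\<chi> \<in> sym_characters n"
      and T: "\<forall>i \<in> {1..m}. product_of_linear n (T i)" and C: "arith_circuit m C"
      and eval: "circuit_eval C T = immanant n \<chi>"
    let ?S = "T ` {1..m}"
    have "linear_product p" if "p \<in> ?S" for p
      using T that unfolding product_of_linear_def linear_product_def by blast
    then obtain h :: "(nat \<times> nat, 'a) mpoly \<Rightarrow> (nat \<times> nat, 'a) mpoly" and P
      where h: "alg_hom h" "finite P" "card P \<le> trdeg ?S"
        "\<forall>x. x \<notin> P \<longrightarrow> h (Var x) = Var x" "\<forall>p \<in> ?S. \<exists>c. h p = Cst c"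
      using linear_products_constant[of ?S] by auto
    obtain c where "h (immanant n \<chi>) = Cst c"
      using circuit_eval_constant[OF h(1) _ C, of T] h(5) eval by auto
    \<comment> \<open>Source of the factor \<open>1 / 4\<close>: \<open>P\<close> involves at most
      \<open>2 * card P\<close> indices, and moving them out of themselves takes twice as much
      room.\<close>
    then have "\<not> 4 * card P \<le> n"
      using immanant_not_constant[OF \<chi> h(1,2)] h(4) n by auto
    with h(3) show "1 / 4 * real n \<le> real (trdeg ?S)"
      by linarith
  qed
qed simp

end
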